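(* For every $d \in \mathbb{N}$ there exists $n_0$ such that for every integer $n \ge n_0$ there exists a graph $G$ with $n(1 + \lceil \sqrt{d} \rceil) + d$ vertices and minimum degree $d$ which does not contain an $\mathcal{S}_\ell$-factor for any $\ell > \lceil \sqrt{d} \rceil + 1$, $\ell \in \mathbb{N}$.
   Context: Graphs are finite and simple. A star of size $k$ is a complete bipartite graph with a single vertex on one side (the centre) and $k$ vertices on the other (the leaves). $\mathcal{S}_\ell$ denotes the family of all stars of size at least $\ell$. For a family $\mathcal{H}$ of graphs, an $\mathcal{H}$-packing in $G$ is a collection of pairwise vertex-disjoint (not necessarily induced) subgraphs of $G$, each isomorphic to a member of $\mathcal{H}$; an $\mathcal{H}$-factor is an $\mathcal{H}$-packing which covers all the vertices of $G$. *)

theory Defs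
  imports Complex_Main "Graph_Theory.Graph_Theory"
begin

text \<open>
  A finite simple graph is a \<^locale>\<open>pair_graph\<close>: a finite loop-free symmetric digraph without
  parallel arcs, each undirected edge being represented by its two orientations. Hence the degree
  of a vertex is its \<^const>\<open>out_degree\<close>. The minimum degree is meaningful only for graphs with
  at least one vertex.
\<close>

definition min_degree :: "'a pair_pre_digraph \<Rightarrow> nat" where
  "min_degree G = Min (out_degree (with_proj G) ` pverts G)"

definition star :: "nat \<Rightarrow> 'a pair_pre_digraph \<Rightarrow> bool" where
  "star k S \<longleftrightarrow> complete_bipartite_digraph 1 k (with_proj S)"

definition star_family :: "nat \<Rightarrow> 'a pair_pre_digraph set" where
  "star_family l = {S. \<exists>k\<ge>l. star k S}"

definition packing :: "'a pair_pre_digraph set \<Rightarrow> 'a pair_pre_digraph \<Rightarrow> 'a pair_pre_digraph set \<Rightarrow> bool" where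
  "packing \<H> G P \<longleftrightarrow>
     (\<forall>H\<in>P. subgraph (with_proj H) (with_proj G) \<and>
            (\<exists>F\<in>\<H>. digraph_iso (with_proj F) (with_proj H))) \<and>
     pairwise (\<lambda>H H'. disjnt (pverts H) (pverts H')) P"

definition is_factor :: "'a pair_pre_digraph set \<Rightarrow> 'a pair_pre_digraph \<Rightarrow> 'a pair_pre_digraph set \<Rightarrow> bool" where
  "is_factor \<H> G P \<longleftrightarrow> packing \<H> G P \<and> (\<Union>H\<in>P. pverts H) = pverts G"

end

theory Submission
  imports Defs "HOL-Library.Nat_Bijection" "HOL-Library.Disjoint_Sets"
begin

text \<open>
  Let \<open>s = \<lceil>sqrt d\<rceil>\<close>, so that \<open>d \<le> s\<^sup>2\<close>. A set \<open>B\<close> of \<open>s + 1\<close> vertices whose neighbours all lie in a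
  set \<open>A\<close> of size \<open>d\<close> is an obstacle: in a factor into stars with at least \<open>s + 2\<close> leaves, the
  vertices of \<open>B\<close> cannot all be centres, as they would need \<open>(s + 1) (s + 2) > d\<close> different leaves in
  \<open>A\<close>. Hence some vertex of \<open>B\<close> is a leaf, and so some vertex of \<open>A\<close> is a centre. If the neighbours of
  \<open>A\<close> lie in \<open>B \<union> C\<close>, then that centre finds at most \<open>s + 1\<close> of its leaves in \<open>B\<close> and has to take one
  from \<open>C\<close>.

  The graph therefore has \<open>d + 1\<close> disjoint gadgets \<open>(A\<^sub>i, B\<^sub>i)\<close> that share a single set \<open>C\<close> of only
  \<open>d\<close> vertices: \<open>A\<^sub>i\<close> is completely joined to \<open>B\<^sub>i\<close> and to \<open>C\<close>. The gadgets would need \<open>d + 1\<close>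
  different leaves in \<open>C\<close>, so there is no factor
  (\<open>no_star_factor_if_gadgets_outnumber_hubs\<close>). Every vertex is adjacent to all of
  some \<open>A\<^sub>i\<close> or to all of \<open>C\<close>, which have size \<open>d\<close>, and the vertices of \<open>B\<^sub>i\<close> have no further neighbours, so the minimum degree is \<open>d\<close>
  (\<open>min_degree_gadget_graph\<close>). Additional vertices joined exactly to \<open>C\<close> do not disturb any of
  this; they bring the number of vertices to any prescribed large value.
\<close>

section \<open>Star factors as centres with leaf sets\<close>

text \<open>
  An isomorphic copy of a star is again a star, and its spokes can be traversed both ways in the
  ambient graph.
\<close>

lemma star_copy_centre_leaves:
  assumes sub: "subgraph (with_proj H) (with_proj G)"
    and F: "F \<in> star_family l"
    and iso: "digraph_iso (with_proj F) (with_proj H)"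
  shows "\<exists>c L. pverts H = insert c L \<and> finite L \<and> l \<le> card L \<and>
           (\<forall>x\<in>L. (c, x) \<in> parcs G \<and> (x, c) \<in> parcs G)"
proof -
  obtain k where k: "k \<ge> l" "complete_bipartite_digraph 1 k (with_proj F)"
    using F by (auto simp: star_family_def star_def)
  then obtain U V where UV: "pverts F = U \<union> V" "U \<inter> V = {}" "card U = 1" "card V = k"
      "parcs F = U \<times> V \<union> V \<times> U" and fin: "finite (pverts F)"
    unfolding complete_bipartite_digraph_pair_def by blast
  from UV(3) obtain u where u: "U = {u}" by (auto simp: card_1_singleton_iff)
  obtain f where f: "pre_digraph.digraph_isomorphism (with_proj F) f"
    and H: "with_proj H = app_iso f (with_proj F)"
    using iso by (auto simp: digraph_iso_def)
  let ?h = "iso_verts f"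
  have vH: "pverts H = ?h ` pverts F" and aH: "parcs H = iso_arcs f ` parcs F"
    and tail: "iso_tail f = fst" and head: "iso_head f = snd"
    using arg_cong[OF H, of verts] arg_cong[OF H, of arcs]
      arg_cong[OF H, of tail] arg_cong[OF H, of head] by simp_all
  have inj: "inj_on ?h (pverts F)"
    and ends: "\<forall>a\<in>parcs F. ?h (fst a) = iso_tail f (iso_arcs f a) \<and> ?h (snd a) = iso_head f (iso_arcs f a)"
    using f by (auto simp: pre_digraph.digraph_isomorphism_def)
  have arc: "(?h x, ?h y) \<in> parcs G" if "(x, y) \<in> parcs F" for x y
  proof -
    have "iso_arcs f (x, y) = (?h x, ?h y)"
      using bspec[OF ends that] by (simp add: tail head prod_eq_iff)
    then have "(?h x, ?h y) \<in> parcs H" using that by (metis aH imageI)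
    then show ?thesis using sub by (auto simp: subgraph_def)
  qed
  have "card (?h ` V) = k"
    using inj UV(1,4) by (metis card_image inj_on_Un)
  moreover have "pverts H = insert (?h u) (?h ` V)" using vH UV(1) u by auto
  moreover have "finite (?h ` V)" using fin UV(1) by simp
  moreover have "\<forall>x\<in>?h ` V. (?h u, x) \<in> parcs G \<and> (x, ?h u) \<in> parcs G"
    using arc UV(5) u by auto
  ultimately show ?thesis using k(1) by blast
qed

lemma star_factor_centres_leaves:
  fixes G :: "'a pair_pre_digraph"
  assumes "is_factor (star_family l) G P"
  shows "\<exists>ctr lvs. \<forall>H\<in>P. pverts H = insert (ctr H) (lvs H) \<and> finite (lvs H) \<and>
           l \<le> card (lvs H) \<and> (\<forall>x\<in>lvs H. (ctr H, x) \<in> parcs G \<and> (x, ctr H) \<in> parcs G)"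
proof -
  define Q where "Q H c L \<longleftrightarrow> pverts H = insert c L \<and> finite L \<and> l \<le> card L \<and>
    (\<forall>x\<in>L. (c, x) \<in> parcs G \<and> (x, c) \<in> parcs G)" for H :: "'a pair_pre_digraph" and c L
  have members: "\<forall>H\<in>P. subgraph (with_proj H) (with_proj G) \<and>
      (\<exists>F\<in>(star_family l :: 'a pair_pre_digraph set). digraph_iso (with_proj F) (with_proj H))"
    using assms unfolding is_factor_def packing_def by (elim conjE)
  have "\<exists>c L. Q H c L" if H: "H \<in> P" for H
  proof -
    from bspec[OF members H] obtain F :: "'a pair_pre_digraph" where "subgraph (with_proj H) (with_proj G)"
        "F \<in> star_family l" "digraph_iso (with_proj F) (with_proj H)"
      by (elim conjE bexE)
    then show ?thesis unfolding Q_def by (rule star_copy_centre_leaves)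
  qed
  then have "\<exists>ctr lvs. \<forall>H\<in>P. Q H (ctr H) (lvs H)" by metis
  then show ?thesis by (simp only: Q_def)
qed

section \<open>The obstruction\<close>

text \<open>
  Each gadget \<open>(A i, B i)\<close> forces a centre in \<open>A i\<close>: otherwise every vertex of \<open>B i\<close> is a centre, and
  their disjoint leaf sets do not fit into \<open>A i\<close>. The star of that centre has more leaves than
  \<open>B i\<close> has vertices, so it claims a leaf in \<open>C\<close>. Different gadgets claim different leaves.
\<close>

lemma no_star_factor_if_gadgets_outnumber_hubs:
  assumes C: "finite C" "card C < card I"
    and B_verts: "\<And>i. i \<in> I \<Longrightarrow> B i \<subseteq> pverts G"
    and nb_B: "\<And>i u v. i \<in> I \<Longrightarrow> u \<in> B i \<Longrightarrow> (u, v) \<in> parcs G \<Longrightarrow> v \<in> A i"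
    and nb_A: "\<And>i u v. i \<in> I \<Longrightarrow> u \<in> A i \<Longrightarrow> (u, v) \<in> parcs G \<Longrightarrow> v \<in> B i \<union> C"
    and fin: "\<And>i. i \<in> I \<Longrightarrow> finite (A i)" "\<And>i. i \<in> I \<Longrightarrow> finite (B i)"
    and disj: "disjoint_family_on A I"
    and card_B: "\<And>i. i \<in> I \<Longrightarrow> card (B i) < l"
    and card_A: "\<And>i. i \<in> I \<Longrightarrow> card (A i) < card (B i) * l"
  shows "\<not> is_factor (star_family l) G P"
proof
  assume P: "is_factor (star_family l) G P"
  obtain ctr lvs where "\<forall>H\<in>P. pverts H = insert (ctr H) (lvs H) \<and> finite (lvs H) \<and>
      l \<le> card (lvs H) \<and> (\<forall>x\<in>lvs H. (ctr H, x) \<in> parcs G \<and> (x, ctr H) \<in> parcs G)"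
    using star_factor_centres_leaves[OF P] by blast
  then have star:
      "\<And>H. H \<in> P \<Longrightarrow> pverts H = insert (ctr H) (lvs H)"
      "\<And>H. H \<in> P \<Longrightarrow> finite (lvs H)"
      "\<And>H. H \<in> P \<Longrightarrow> l \<le> card (lvs H)"
      "\<And>H x. H \<in> P \<Longrightarrow> x \<in> lvs H \<Longrightarrow> (ctr H, x) \<in> parcs G"
      "\<And>H x. H \<in> P \<Longrightarrow> x \<in> lvs H \<Longrightarrow> (x, ctr H) \<in> parcs G"
    by simp_all
  have cover: "(\<Union>H\<in>P. pverts H) = pverts G"
    using P by (simp add: is_factor_def)
  have "pairwise (\<lambda>H H'. disjnt (pverts H) (pverts H')) P"
    using P by (simp add: is_factor_def packing_def)
  then have same: "H = H'" if "H \<in> P" "H' \<in> P" "x \<in> pverts H" "x \<in> pverts H'" for H H' x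
    using that by (auto simp: pairwise_def disjnt_iff)
  have centre: "\<exists>H\<in>P. ctr H \<in> A i" if i: "i \<in> I" for i
  proof (rule ccontr)
    assume no: "\<not> ?thesis"
    have "\<exists>H\<in>P. ctr H = b" if b: "b \<in> B i" for b
    proof -
      obtain H where H: "H \<in> P" "b \<in> pverts H" using cover B_verts[OF i] b by blast
      have "b \<notin> lvs H" using no nb_B[OF i b] star(5)[OF H(1)] H(1) by blast
      then show ?thesis using H star(1)[OF H(1)] by auto
    qed
    then obtain S where S: "\<And>b. b \<in> B i \<Longrightarrow> S b \<in> P" "\<And>b. b \<in> B i \<Longrightarrow> ctr (S b) = b"
      by metis
    have "l \<le> card (lvs (S b))" if "b \<in> B i" for b
      by (rule star(3)[OF S(1)[OF that]])
    then have "card (B i) * l \<le> (\<Sum>b\<in>B i. card (lvs (S b)))"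
      using sum_bounded_below[of "B i" l "\<lambda>b. card (lvs (S b))"] by simp
    also have "\<dots> = card (\<Union>b\<in>B i. lvs (S b))"
    proof (rule card_UN_disjoint[symmetric])
      show "\<forall>b\<in>B i. \<forall>b'\<in>B i. b \<noteq> b' \<longrightarrow> lvs (S b) \<inter> lvs (S b') = {}"
      proof (intro ballI impI equals0I)
        fix b b' x assume b: "b \<in> B i" "b' \<in> B i" "b \<noteq> b'" "x \<in> lvs (S b) \<inter> lvs (S b')"
        then have "x \<in> pverts (S b)" "x \<in> pverts (S b')" using star(1) S(1) by simp_all
        then have "S b = S b'" using same S(1) b(1,2) by blast
        then show False using S(2)[OF b(1)] S(2)[OF b(2)] b(3) by simp
      qed
      show "finite (B i)" by (rule fin(2)[OF i])
      show "\<forall>b\<in>B i. finite (lvs (S b))" using S(1) star(2) by blast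
    qed
    also have "\<dots> \<le> card (A i)"
    proof (rule card_mono[OF fin(1)[OF i]])
      show "(\<Union>b\<in>B i. lvs (S b)) \<subseteq> A i"
      proof
        fix x assume "x \<in> (\<Union>b\<in>B i. lvs (S b))"
        then obtain b where b: "b \<in> B i" "x \<in> lvs (S b)" by blast
        then have "(b, x) \<in> parcs G" using star(4)[OF S(1)[OF b(1)] b(2)] S(2)[OF b(1)] by simp
        then show "x \<in> A i" using nb_B i b(1) by blast
      qed
    qed
    finally show False using card_A[OF i] by simp
  qed
  then obtain S where S: "\<And>i. i \<in> I \<Longrightarrow> S i \<in> P" "\<And>i. i \<in> I \<Longrightarrow> ctr (S i) \<in> A i"
    by metis
  have "\<exists>x. x \<in> lvs (S i) \<and> x \<in> C" if i: "i \<in> I" for i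
  proof (rule ccontr)
    assume "\<not> ?thesis"
    moreover have "x \<in> B i \<union> C" if "x \<in> lvs (S i)" for x
      by (rule nb_A[OF i S(2)[OF i] star(4)[OF S(1)[OF i] that]])
    ultimately have "lvs (S i) \<subseteq> B i" by blast
    then have "card (lvs (S i)) \<le> card (B i)" by (rule card_mono[OF fin(2)[OF i]])
    then show False using star(3)[OF S(1)[OF i]] card_B[OF i] by linarith
  qed
  then obtain g where g: "\<And>i. i \<in> I \<Longrightarrow> g i \<in> lvs (S i)" "\<And>i. i \<in> I \<Longrightarrow> g i \<in> C"
    by metis
  have "inj_on g I"
  proof (rule inj_onI, rule ccontr)
    fix i j assume ij: "i \<in> I" "j \<in> I" "g i = g j" "i \<noteq> j"
    have "g i \<in> pverts (S i)" "g i \<in> pverts (S j)"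
      using g(1)[OF ij(1)] g(1)[OF ij(2)] star(1)[OF S(1)] ij by simp_all
    then have "S i = S j" using same S(1) ij(1,2) by blast
    then have "ctr (S i) \<in> A i \<inter> A j" using S(2)[OF ij(1)] S(2)[OF ij(2)] by simp
    then show False using disj ij(1,2,4) by (auto simp: disjoint_family_on_def)
  qed
  then have "card I \<le> card C" using g(2) C(1) by (meson card_inj_on_le image_subsetI)
  then show False using C(2) by simp
qed

section \<open>The graph\<close>

text \<open>
  Layers with different indices are disjoint, so they serve as vertex classes of prescribed sizes
  inside the natural numbers.
\<close>

definition layer :: "nat \<Rightarrow> nat \<Rightarrow> nat set" where
  "layer j n = (\<lambda>t. prod_encode (j, t)) ` {..<n}"

lemma finite_layer [simp]: "finite (layer j n)"
  by (simp add: layer_def)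

lemma card_layer [simp]: "card (layer j n) = n"
  by (simp add: layer_def card_image inj_on_def)

lemma layer_index_unique: "x \<in> layer j n \<Longrightarrow> x \<in> layer j' n' \<Longrightarrow> j = j'"
  by (auto simp: layer_def)

text \<open>
  In the notation of the introduction: the hubs form \<open>C\<close>, the shells are the \<open>A\<^sub>i\<close> and the cores
  the \<open>B\<^sub>i\<close>. The fillers only adjust the number of vertices.
\<close>

definition hubs :: "nat \<Rightarrow> nat set" where
  "hubs d = layer 0 d"

definition fillers :: "nat \<Rightarrow> nat set" where
  "fillers r = layer 1 r"

definition shell :: "nat \<Rightarrow> nat \<Rightarrow> nat set" where
  "shell d i = layer (2 * i + 2) d"

definition core :: "nat \<Rightarrow> nat \<Rightarrow> nat set" where
  "core b i = layer (2 * i + 3) b"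

lemmas class_defs = hubs_def fillers_def shell_def core_def

lemma finite_class: "finite (hubs d)" "finite (fillers r)" "finite (shell d i)" "finite (core b i)"
  by (simp_all add: class_defs)

lemma card_class:
  "card (hubs d) = d" "card (fillers r) = r" "card (shell d i) = d" "card (core b i) = b"
  by (simp_all add: class_defs)

lemma class_disjoint:
  "x \<in> hubs d \<Longrightarrow> x \<notin> fillers r" "x \<in> hubs d \<Longrightarrow> x \<notin> shell d i" "x \<in> hubs d \<Longrightarrow> x \<notin> core b i"
  "x \<in> fillers r \<Longrightarrow> x \<notin> shell d i" "x \<in> fillers r \<Longrightarrow> x \<notin> core b i"
  "x \<in> shell d i \<Longrightarrow> x \<notin> core b j"
  "x \<in> shell d i \<Longrightarrow> x \<in> shell d j \<Longrightarrow> i = j"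
  "x \<in> core b i \<Longrightarrow> x \<in> core b j \<Longrightarrow> i = j"
  unfolding class_defs by ((rule notI)?, drule (1) layer_index_unique, presburger)+

text \<open>
  Each edge in one orientation only; \<open>gadget_graph\<close> adds the reversed arcs.
\<close>

definition gadget_edges :: "nat \<Rightarrow> nat \<Rightarrow> nat \<Rightarrow> nat \<Rightarrow> (nat \<times> nat) set" where
  "gadget_edges d b m r =
     hubs d \<times> (fillers r \<union> (\<Union>i<m. shell d i)) \<union> (\<Union>i<m. shell d i \<times> core b i)"

definition gadget_graph :: "nat \<Rightarrow> nat \<Rightarrow> nat \<Rightarrow> nat \<Rightarrow> nat pair_pre_digraph" where
  "gadget_graph d b m r =
     \<lparr> pverts = hubs d \<union> fillers r \<union> (\<Union>i<m. shell d i \<union> core b i),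
       parcs = gadget_edges d b m r \<union> (gadget_edges d b m r)\<inverse> \<rparr>"

lemma pair_graph_gadget_graph: "pair_graph (gadget_graph d b m r)"
proof -
  let ?G = "gadget_graph d b m r"
  have verts: "finite (pverts ?G)"
    by (simp add: gadget_graph_def class_defs)
  have arcs: "parcs ?G \<subseteq> pverts ?G \<times> pverts ?G"
    by (auto simp: gadget_graph_def gadget_edges_def)
  have loops: "fst e \<noteq> snd e" if "e \<in> parcs ?G" for e
    using that by (auto simp: gadget_graph_def gadget_edges_def dest: class_disjoint)
  have sym: "symmetric (with_proj ?G)"
    by (auto simp: symmetric_def gadget_graph_def intro!: symI)
  show ?thesis
    using verts arcs loops sym finite_subset[OF arcs]
    by unfold_locales auto
qed

lemma card_gadget_graph: "card (pverts (gadget_graph d b m r)) = d + r + m * (d + b)"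
proof -
  have "shell d i \<inter> core b i = {}" for i
    by (auto dest: class_disjoint)
  then have gadget: "card (shell d i \<union> core b i) = d + b" for i
    using finite_class by (simp add: card_Un_disjoint card_class)
  have gadgets_disjoint: "(shell d i \<union> core b i) \<inter> (shell d j \<union> core b j) = {}" if "i \<noteq> j" for i j
    using that class_disjoint(6-8) by blast
  have "card (\<Union>i<m. shell d i \<union> core b i) = (\<Sum>i<m. card (shell d i \<union> core b i))"
    by (rule card_UN_disjoint) (use gadgets_disjoint in \<open>auto simp: finite_class\<close>)
  then have gadgets: "card (\<Union>i<m. shell d i \<union> core b i) = m * (d + b)"
    by (simp add: gadget)
  have "hubs d \<inter> fillers r = {}"
    by (auto dest: class_disjoint)
  then have "card (hubs d \<union> fillers r) = d + r"
    using finite_class by (simp add: card_Un_disjoint card_class)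
  moreover have "(hubs d \<union> fillers r) \<inter> (\<Union>i<m. shell d i \<union> core b i) = {}"
    by (auto simp: class_disjoint)
  ultimately show ?thesis
    unfolding gadget_graph_def using gadgets by (simp add: card_Un_disjoint finite_class)
qed

lemma out_degree_with_proj: "out_degree (with_proj G) v = card {w. (v, w) \<in> parcs G}"
proof -
  have "out_arcs (with_proj G) v = Pair v ` {w. (v, w) \<in> parcs G}"
    by (auto simp: out_arcs_def)
  then show ?thesis by (simp add: out_degree_def card_image inj_on_def)
qed

text \<open>
  Hubs see a whole shell; shells and fillers see all hubs; a core sees exactly its own shell. Each
  of these sets has \<open>d\<close> elements.
\<close>

lemma min_degree_gadget_graph:
  assumes "0 < m" "0 < b"
  shows "min_degree (gadget_graph d b m r) = d"
proof -
  let ?G = "gadget_graph d b m r"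
  let ?N = "\<lambda>v. {w. (v, w) \<in> parcs ?G}"
  interpret pair_graph ?G by (rule pair_graph_gadget_graph)
  have "?N v \<subseteq> pverts ?G" for v
    by (auto simp: gadget_graph_def gadget_edges_def)
  then have finN: "finite (?N v)" for v
    using pair_finite_verts by (rule finite_subset)
  have lower: "d \<le> card (?N v)" if "v \<in> pverts ?G" for v
  proof -
    have "\<exists>j. layer j d \<subseteq> ?N v"
    proof -
      have "v \<in> hubs d \<or> v \<in> fillers r \<or> (\<exists>i<m. v \<in> shell d i) \<or> (\<exists>i<m. v \<in> core b i)"
        using that by (auto simp: gadget_graph_def)
      then consider "v \<in> hubs d" | "v \<in> fillers r" | i where "i < m" "v \<in> shell d i"
        | i where "i < m" "v \<in> core b i"
        by blast
      then show ?thesis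
      proof cases
        case 1
        then have "shell d 0 \<subseteq> ?N v"
          using assms by (auto simp: gadget_graph_def gadget_edges_def)
        then show ?thesis by (auto simp: shell_def)
      next
        case 2
        then have "hubs d \<subseteq> ?N v" by (auto simp: gadget_graph_def gadget_edges_def)
        then show ?thesis by (auto simp: hubs_def)
      next
        case 3
        then have "hubs d \<subseteq> ?N v" by (auto simp: gadget_graph_def gadget_edges_def)
        then show ?thesis by (auto simp: hubs_def)
      next
        case 4
        then have "shell d i \<subseteq> ?N v" by (auto simp: gadget_graph_def gadget_edges_def)
        then show ?thesis by (auto simp: shell_def)
      qed
    qed
    then obtain j where "layer j d \<subseteq> ?N v" ..
    from card_mono[OF finN this] show ?thesis by simp
  qed
  have "core b 0 \<noteq> {}" using assms card_class(4)[of b 0] by auto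
  then obtain v where v: "v \<in> core b 0" by auto
  then have "?N v = shell d 0"
    using assms by (auto simp: gadget_graph_def gadget_edges_def dest: class_disjoint)
  then have attained: "card (?N v) = d" by (simp add: shell_def)
  have "v \<in> pverts ?G" using v assms by (auto simp: gadget_graph_def)
  then have "d \<in> (\<lambda>v. card (?N v)) ` pverts ?G"
    by (intro image_eqI[where x = v]) (simp_all add: attained)
  then show ?thesis
    unfolding min_degree_def out_degree_with_proj
    using lower pair_finite_verts by (intro Min_eqI) auto
qed

lemma gadget_graph_no_star_factor:
  assumes "d < m" "b < l" "d < b * l"
  shows "\<not> is_factor (star_family l) (gadget_graph d b m r) P"
proof (rule no_star_factor_if_gadgets_outnumber_hubs
    [where C = "hubs d" and I = "{..<m}" and A = "shell d" and B = "core b"])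
  show "core b i \<subseteq> pverts (gadget_graph d b m r)" if "i \<in> {..<m}" for i
    using that by (auto simp: gadget_graph_def)
  show "v \<in> shell d i" if "u \<in> core b i" "(u, v) \<in> parcs (gadget_graph d b m r)" for i u v
    using that by (auto simp: gadget_graph_def gadget_edges_def dest: class_disjoint)
  show "v \<in> core b i \<union> hubs d" if "u \<in> shell d i" "(u, v) \<in> parcs (gadget_graph d b m r)" for i u v
    using that by (auto simp: gadget_graph_def gadget_edges_def dest: class_disjoint)
  show "disjoint_family_on (shell d) {..<m}"
    by (auto simp: disjoint_family_on_def dest: class_disjoint)
qed (use assms in \<open>simp_all add: class_defs\<close>)

theorem theorem1p2:
  fixes d :: nat
  shows "\<exists>n\<^sub>0::nat. \<forall>n\<ge>n\<^sub>0. \<exists>G :: nat pair_pre_digraph.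
    pair_graph G \<and>
    int (card (pverts G)) = int n * (1 + \<lceil>sqrt (real d)\<rceil>) + int d \<and>
    min_degree G = d \<and>
    (\<forall>l::nat. int l > \<lceil>sqrt (real d)\<rceil> + 1 \<longrightarrow> \<not> (\<exists>P. is_factor (star_family l) G P))"
proof -
  define s where "s = nat \<lceil>sqrt (real d)\<rceil>"
  have "0 \<le> \<lceil>sqrt (real d)\<rceil>" using ceiling_mono[of 0 "sqrt (real d)"] by simp
  then have s: "\<lceil>sqrt (real d)\<rceil> = int s" by (simp add: s_def)
  have "sqrt (real d) \<le> real s" using le_of_int_ceiling[of "sqrt (real d)"] by (simp add: s)
  then have "real d \<le> real (s ^ 2)" by (metis of_nat_power sqrt_le_D)
  then have ds: "d \<le> s * s" by (simp only: of_nat_le_iff power2_eq_square)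
  \<comment> \<open>The gadgets have \<open>k\<close> vertices in total; the hubs contribute the summand \<open>d\<close> and the fillers
    make up the rest of \<open>n (s + 1)\<close>.\<close>
  define k where "k = (d + 1) * (d + (s + 1))"
  show ?thesis
  proof (intro exI[of _ k] allI impI)
    fix n assume n: "k \<le> n"
    define r where "r = n * (s + 1) - k"
    define G where "G = gadget_graph d (s + 1) (d + 1) r"
    have "n \<le> n * (s + 1)" by simp
    then have "card (pverts G) = n * (s + 1) + d"
      unfolding G_def card_gadget_graph r_def k_def[symmetric] using n by linarith
    then have "int (card (pverts G)) = int n * (1 + \<lceil>sqrt (real d)\<rceil>) + int d"
      by (simp add: s algebra_simps)
    moreover have "\<not> is_factor (star_family l) G P" if "int l > \<lceil>sqrt (real d)\<rceil> + 1" for l P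
    proof -
      have l: "s + 1 < l" using that s by simp
      have "s * s < (s + 1) * (s + 1)" by simp
      also have "\<dots> \<le> (s + 1) * l" using l by (intro mult_left_mono) simp_all
      finally show ?thesis
        unfolding G_def using ds l by (intro gadget_graph_no_star_factor) simp_all
    qed
    moreover have "pair_graph G" "min_degree G = d"
      by (simp_all add: G_def pair_graph_gadget_graph min_degree_gadget_graph)
    ultimately show "\<exists>G :: nat pair_pre_digraph. pair_graph G \<and>
        int (card (pverts G)) = int n * (1 + \<lceil>sqrt (real d)\<rceil>) + int d \<and> min_degree G = d \<and>
        (\<forall>l. int l > \<lceil>sqrt (real d)\<rceil> + 1 \<longrightarrow> \<not> (\<exists>P. is_factor (star_family l) G P))"
      by (intro exI[of _ G]) simp
  qed
qed

end
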